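(* Let $(Y,d)$ be a complete locally compact metric space such that through any two points of $Y$ passes a geodesic line. Then for every family $(B(x_n,r_n))_{n\in\mathbb{N}}$ of balls in $Y$ with $0<r_n\le1$ for all $n$ and $d(x_n,x_m)^2\ge4r_nr_m$ for all $n\ne m$, the scaled family of balls $(B(x_n,sr_n))_{n\in\mathbb{N}}$ does not cover $Y$ if $s<\sqrt5-2$.
   Context: Balls are closed: $B(x,r)=\{y\in Y: d(x,y)\le r\}$. A geodesic line is the image of an isometric embedding $\mathbb{R}\to Y$. Here $s\ge0$. *)

theory Defs
  imports "HOL-Analysis.Analysis"
begin

definition geodesic_line :: "'a::metric_space set \<Rightarrow> bool" where
  "geodesic_line L \<longleftrightarrow>
     (\<exists>\<gamma> :: real \<Rightarrow> 'a. (\<forall>t u. dist (\<gamma> t) (\<gamma> u) = dist t u) \<and> L = range \<gamma>)"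

end

theory Submission
  imports Defs
begin

text \<open>
  Process the balls scale by scale, the scale \<open>k\<close> consisting of those with radius in
  \<open>]4\<^sup>-\<^sup>k\<^sup>-\<^sup>1, 4\<^sup>-\<^sup>k]\<close>. If the current point lies at distance less than \<open>4/5 r\<^sub>n\<close> from a centre
  \<open>x\<^sub>n\<close> of the current scale, push it away from \<open>x\<^sub>n\<close>, along a geodesic line, to distance exactly
  \<open>4/5 r\<^sub>n\<close>. The separation hypothesis forces two balls whose \<open>4/5\<close>-multiples meet to have radii
  of ratio at least 4, so a push leaves the other balls of the same scale alone, and radii of
  successive pushes decrease by a factor 4. The pushes from \<open>x\<^sub>n\<close> on thus have total length at most
  \<open>16/15 r\<^sub>n\<close>. The points converge, and the limit is at distance more than \<open>r\<^sub>l/2\<close> from every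
  \<open>x\<^sub>l\<close>: otherwise the first push after the scale of \<open>x\<^sub>l\<close> comes from a ball too large and too
  close to be separated from that of \<open>x\<^sub>l\<close>. Since \<open>sqrt 5 - 2 < 1/2\<close>, this suffices.
\<close>

text \<open>The constants 4/5 and 4 match: \<open>4 * u * v \<le> (4/5 * (u + v))\<^sup>2\<close>
  amounts to \<open>(4 * u - v) * (4 * v - u) \<le> 0\<close>.\<close>

lemma separated_radii_ratio:
  fixes u v D :: real
  assumes "0 < u" "0 < v" "0 \<le> D" "D\<^sup>2 \<ge> 4 * u * v" "D \<le> 4/5 * (u + v)"
  shows "4 * u \<le> v \<or> 4 * v \<le> u"
proof (rule ccontr)
  assume "\<not> ?thesis"
  then have "(4 * u - v) * (4 * v - u) > 0" by simp
  moreover have "D\<^sup>2 \<le> (4/5 * (u + v))\<^sup>2" using assms by (intro power_mono)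
  ultimately show False using assms(4) by (simp add: power2_eq_square algebra_simps)
qed

lemma geodesic_push:
  fixes p q :: "'a::metric_space"
  assumes lines: "\<And>p q :: 'a. p \<noteq> q \<Longrightarrow> \<exists>L. geodesic_line L \<and> p \<in> L \<and> q \<in> L"
    and other: "w \<noteq> p" and R: "dist p q \<le> R"
  obtains z where "dist p z = R" "dist q z \<le> R"
proof -
  \<comment> \<open>A centre to be left determines no direction, so \<open>w\<close> serves as
    second point of the line if \<open>q = p\<close>.\<close>
  define q' where "q' = (if q = p then w else q)"
  have "p \<noteq> q'" using other by (auto simp: q'_def)
  from lines[OF this] obtain \<gamma> :: "real \<Rightarrow> 'a" and t u where
    iso: "\<And>t u. dist (\<gamma> t) (\<gamma> u) = dist t u" and t: "p = \<gamma> t" and u: "q' = \<gamma> u"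
    unfolding geodesic_line_def by blast
  have R0: "0 \<le> R" using R zero_le_dist[of p q] by linarith
  \<comment> \<open>The sign puts \<open>z\<close> on the same side of \<open>p\<close> as
    \<open>q\<close>, whence \<open>dist q z = R - dist p q\<close> for
    \<open>q \<noteq> p\<close>.\<close>
  define z where "z = \<gamma> (if t \<le> u then t + R else t - R)"
  have pz: "dist p z = R" using R0 by (simp add: z_def t iso dist_real_def)
  moreover have "dist q z \<le> R"
  proof (cases "q = p")
    case False
    then have q: "q = \<gamma> u" by (simp add: q'_def u[symmetric])
    have "\<bar>t - u\<bar> \<le> R" using R by (simp add: q t iso dist_real_def)
    then show ?thesis using R0 by (auto simp: z_def q iso dist_real_def)
  qed (use pz in simp)
  ultimately show thesis by (rule that)
qed

lemma power_scale_exists: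
  fixes r :: real
  assumes "0 < r" "r \<le> 1"
  obtains k where "(1/4) ^ Suc k < r" "r \<le> (1/4) ^ k"
proof -
  obtain m where "(1/4::real) ^ m < r"
    using real_arch_pow_inv[of r "1/4"] assms by auto
  then have least: "(1/4::real) ^ (LEAST m. (1/4) ^ m < r) < r"
    by (rule LeastI)
  then have "(LEAST m. (1/4) ^ m < r) \<noteq> 0" using assms by (metis not_le power_0)
  then obtain k where k: "(LEAST m. (1/4) ^ m < r) = Suc k" using not0_implies_Suc by blast
  then have "\<not> (1/4) ^ k < r" by (metis lessI not_less_Least)
  then show thesis using that least k by (metis not_le)
qed

lemma separated_half_balls_not_cover:
  fixes x :: "nat \<Rightarrow> 'a::complete_space" and r :: "nat \<Rightarrow> real"
  assumes lines: "\<And>p q :: 'a. p \<noteq> q \<Longrightarrow> \<exists>L. geodesic_line L \<and> p \<in> L \<and> q \<in> L"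
    and r: "\<And>n. 0 < r n \<and> r n \<le> 1"
    and sep: "\<And>n m. n \<noteq> m \<Longrightarrow> (dist (x n) (x m))\<^sup>2 \<ge> 4 * r n * r m"
  shows "\<exists>y. \<forall>n. dist y (x n) > r n / 2"
proof -
  have rpos: "0 < r n" and r1: "r n \<le> 1" for n using r by auto
  define scale where "scale k n \<longleftrightarrow> (1/4) ^ Suc k < r n \<and> r n \<le> (1/4) ^ k" for k n
  have ratio: "4 * r n \<le> r m \<or> 4 * r m \<le> r n"
    if "n \<noteq> m" "dist (x n) (x m) \<le> 4/5 * (r n + r m)" for n m
    using separated_radii_ratio[OF rpos rpos zero_le_dist sep[OF that(1)] that(2)] .
  have scale_less: "r m < r n" if "scale k n" "scale j m" "k < j" for k j n m
  proof -
    have "(1/4::real) ^ j \<le> (1/4) ^ Suc k" using that(3) by (intro power_decreasing) auto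
    then show ?thesis using that(1,2) by (auto simp: scale_def)
  qed
  have scale_close: "r m < 4 * r n" if "scale k n" "scale k m" for k n m
    using that by (auto simp: scale_def)
  define push where "push k y z n \<longleftrightarrow> scale k n \<and> dist (x n) y < 4/5 * r n
      \<and> dist (x n) z = 4/5 * r n \<and> dist y z \<le> 4/5 * r n" for k y z n
  define stay where "stay k y z \<longleftrightarrow> z = y \<and> (\<forall>n. scale k n \<longrightarrow> dist (x n) y \<ge> 4/5 * r n)"
    for k and y z :: 'a
  have "\<exists>z. stay k y z \<or> (\<exists>n. push k y z n)" for k y
  proof (cases "\<exists>n. scale k n \<and> dist (x n) y < 4/5 * r n")
    case True
    then obtain n where n: "scale k n" "dist (x n) y < 4/5 * r n" by blast
    \<comment> \<open>Separation makes the centres distinct, which yields the second point that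
      \<open>geodesic_push\<close> asks for.\<close>
    have "0 < 4 * r (Suc n) * r n" using rpos by simp
    then have "0 < (dist (x (Suc n)) (x n))\<^sup>2" using sep[of "Suc n" n] by linarith
    then have "x (Suc n) \<noteq> x n" by auto
    then obtain z where "dist (x n) z = 4/5 * r n" "dist y z \<le> 4/5 * r n"
      using geodesic_push[OF lines _ less_imp_le[OF n(2)]] by blast
    with n show ?thesis unfolding push_def by blast
  next
    case False
    then show ?thesis by (auto simp: stay_def not_less)
  qed
  then obtain y where step: "\<And>k. stay k (y k) (y (Suc k)) \<or> (\<exists>n. push k (y k) (y (Suc k)) n)"
    using dependent_nat_choice[of "\<lambda>_ _. True" "\<lambda>k y z. stay k y z \<or> (\<exists>n. push k y z n)"]
    by metis
  define moves where "moves k n \<longleftrightarrow> push k (y k) (y (Suc k)) n" for k n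
  have no_move: "y (Suc k) = y k" if "\<And>n. \<not> moves k n" for k
    using step[of k] that by (auto simp: stay_def moves_def)
  \<comment> \<open>The equation \<open>y i = y k\<close> records that nothing has moved before the
    push at \<open>i\<close>.\<close>
  have first_move: "y j = y k \<or> (\<exists>i n. k \<le> i \<and> i < j \<and> moves i n \<and> y i = y k)"
    if "k \<le> j" for k j
    using that
  proof (induction j rule: dec_induct)
    case (step j)
    then show ?case using no_move[of j] by (metis less_Suc_eq)
  qed simp
  \<comment> \<open>Even a push from another centre of scale \<open>k\<close> cannot end too near
    \<open>x l\<close>: the 4/5-balls of one scale are disjoint by \<open>ratio\<close>.\<close>
  have avoid: "dist (x l) (y (Suc k)) \<ge> 4/5 * r l" if l: "scale k l" for k l
  proof (cases "\<exists>n. moves k n")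
    case True
    then obtain n where n: "push k (y k) (y (Suc k)) n" by (auto simp: moves_def)
    show ?thesis
    proof (rule ccontr)
      assume *: "\<not> ?thesis"
      then have "n \<noteq> l" using n by (auto simp: push_def)
      moreover have "dist (x n) (x l) \<le> 4/5 * (r n + r l)"
        using dist_triangle2[of "x n" "x l" "y (Suc k)"] n * by (auto simp: push_def)
      ultimately have "4 * r n \<le> r l \<or> 4 * r l \<le> r n" by (rule ratio)
      then show False
        using scale_close[OF l, of n] scale_close[of k n l] n l by (auto simp: push_def)
    qed
  next
    case False
    then show ?thesis using step[of k] l by (auto simp: stay_def moves_def)
  qed
  \<comment> \<open>The point \<open>y i\<close> lies in the 4/5-balls of both \<open>x n\<close>
    and \<open>x m\<close>, so \<open>ratio\<close> applies.\<close>
  have next_move: "4 * r m \<le> r n"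
    if n: "moves k n" and m: "moves i m" and "k < i" and yi: "y i = y (Suc k)" for k n i m
  proof -
    have less: "r m < r n" using scale_less that by (auto simp: moves_def push_def)
    have "dist (x n) (x m) \<le> 4/5 * (r n + r m)"
      using dist_triangle2[of "x n" "x m" "y i"] n m yi by (auto simp: moves_def push_def)
    then show ?thesis using ratio[of n m] less rpos[of n] by fastforce
  qed
  \<comment> \<open>\<open>16/15 = 4/5 * (1 + 1/4 + 1/16 + \<dots>)\<close>\<close>
  have drift: "dist p (y j) \<le> 16/15 * r n"
    if "moves k n" "k < j" "dist p (y (Suc k)) \<le> 4/5 * r n" for k j n p
    using that
  proof (induction "j - k" arbitrary: k n p rule: less_induct)
    case less
    from less.prems(2) have "Suc k \<le> j" by simp
    from first_move[OF this] consider "y j = y (Suc k)"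
      | i m where "Suc k \<le> i" "i < j" "moves i m" "y i = y (Suc k)" by blast
    then show ?case
    proof cases
      case 1
      then show ?thesis using less.prems(3) rpos[of n] by simp
    next
      case 2
      have "dist (y i) (y (Suc i)) \<le> 4/5 * r m" using 2(3) by (simp add: moves_def push_def)
      then have "dist (y i) (y j) \<le> 16/15 * r m" using 2 by (intro less.hyps) auto
      moreover have "4 * r m \<le> r n" using next_move[OF less.prems(1) 2(3) _ 2(4)] 2(1) by simp
      \<comment> \<open>The bound closes up since
        \<open>4/5 * r n + 16/15 * (r n / 4) = 16/15 * r n\<close>.\<close>
      ultimately show ?thesis
        using less.prems(3) 2(4) dist_triangle[of p "y j" "y i"] by simp
    qed
  qed
  \<comment> \<open>A push bounds the distances of its endpoint to its starting point and to its
    centre alike, so \<open>p\<close> can be either.\<close>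
  have drift_point: "dist (y k) (y j) \<le> 16/15 * r n"
    and drift_centre: "dist (x n) (y j) \<le> 16/15 * r n" if "moves k n" "k < j" for k j n
    by (rule drift[OF that], use that(1) in \<open>simp add: moves_def push_def\<close>)+
  have small: "dist (y k) (y j) \<le> 16/15 * (1/4) ^ k" if "k \<le> j" for k j
    using first_move[OF that]
  proof (elim disjE exE conjE)
    fix i n assume *: "k \<le> i" "i < j" "moves i n" "y i = y k"
    have "r n \<le> (1/4) ^ i" using *(3) by (auto simp: moves_def push_def scale_def)
    also have "\<dots> \<le> (1/4) ^ k" using *(1) by (intro power_decreasing) auto
    finally show ?thesis using drift_point[OF *(3,2)] *(4) by simp
  qed simp
  have "Cauchy y"
  proof (rule metric_CauchyI)
    fix e :: real assume "0 < e"
    then obtain k where k: "(1/4::real) ^ k < e / 4" using real_arch_pow_inv[of "e/4" "1/4"] by auto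
    have "dist (y m) (y n) < e" if "k \<le> m" "k \<le> n" for m n
      using small[OF that(1)] small[OF that(2)] dist_triangle3[of "y m" "y n" "y k"] k \<open>0 < e\<close>
      by linarith
    then show "\<exists>M. \<forall>m\<ge>M. \<forall>n\<ge>M. dist (y m) (y n) < e" by blast
  qed
  then obtain Y where Y: "y \<longlonglongrightarrow> Y" using Cauchy_convergent convergent_def by blast
  have limit: "dist p Y \<le> c" if "\<And>j. k < j \<Longrightarrow> dist p (y j) \<le> c" for p c k
  proof (rule tendsto_upperbound)
    show "(\<lambda>j. dist p (y j)) \<longlonglongrightarrow> dist p Y" using Y by (intro tendsto_intros)
    show "\<forall>\<^sub>F j in sequentially. dist p (y j) \<le> c"
      using eventually_gt_at_top[of k] by eventually_elim (rule that)
  qed simp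
  have "dist Y (x l) > r l / 2" for l
  proof -
    obtain k where k: "scale k l"
      using power_scale_exists[OF rpos[of l] r1[of l]] unfolding scale_def by blast
    show ?thesis
    proof (cases "\<forall>j\<ge>Suc k. y j = y (Suc k)")
      case True
      have "dist (y (Suc k)) Y \<le> 0"
      proof (rule limit[of k])
        fix j assume "k < j"
        with True have "y j = y (Suc k)" using Suc_leI by blast
        then show "dist (y (Suc k)) (y j) \<le> 0" by simp
      qed
      then show ?thesis using avoid[OF k] rpos[of l] by (simp add: dist_commute)
    next
      case False
      then obtain j where "Suc k \<le> j" "y j \<noteq> y (Suc k)" by blast
      then obtain i n where i: "Suc k \<le> i" "moves i n" "y i = y (Suc k)"
        using first_move by blast
      have less: "r n < r l" using scale_less[OF k] i by (auto simp: moves_def push_def)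
      have Yi: "dist (y i) Y \<le> 16/15 * r n"
        by (rule limit, erule drift_point[OF i(2)])
      have Yn: "dist (x n) Y \<le> 16/15 * r n"
        by (rule limit, erule drift_centre[OF i(2)])
      show ?thesis
      proof (rule ccontr)
        assume "\<not> ?thesis"
        then have close: "dist Y (x l) \<le> r l / 2" by simp
        \<comment> \<open>From \<open>4/5 * r l \<le> 16/15 * r n + r l / 2\<close>.\<close>
        have lower: "9/32 * r l \<le> r n"
          using avoid[OF k] close Yi dist_triangle[of "y i" "x l" Y]
          unfolding i(3) dist_commute[of "x l" "y (Suc k)"] by linarith
        have "dist (x n) (x l) \<le> 16/15 * r n + r l / 2"
          using close Yn dist_triangle[of "x n" "x l" Y] by linarith
        then have "(dist (x n) (x l))\<^sup>2 \<le> (16/15 * r n + r l / 2)\<^sup>2"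
          by (intro power_mono) auto
        moreover have "4 * r n * r l \<le> (dist (x n) (x l))\<^sup>2" using sep[of n l] less by (cases "n = l") auto
        ultimately have "4 * (r n * r l) \<le> 256/225 * (r n * r n) + 16/15 * (r n * r l)
            + 1/4 * (r l * r l)"
          by (simp add: power2_eq_square algebra_simps)
        moreover have "r n * r n \<le> r n * r l" using less rpos[of n] by simp
        moreover have "9/32 * (r l * r l) \<le> r n * r l"
          using mult_right_mono[OF lower, of "r l"] rpos[of l] by simp
        moreover have "0 < r l * r l" using rpos by simp
        \<comment> \<open>The right-hand side is at most \<open>256/225 + 16/15 + 8/9 < 4\<close>
          times \<open>r n * r l\<close>, where 8/9 is \<open>1/4 * 32/9\<close>.\<close>
        ultimately show False by linarith
      qed
    qed
  qed
  then show ?thesis by blast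
qed

theorem proposition1p3:
  fixes x :: "nat \<Rightarrow> 'a::complete_space" and r :: "nat \<Rightarrow> real" and s :: real
  assumes "locally_compact_space (euclidean :: 'a topology)"
    and "\<And>p q :: 'a. p \<noteq> q \<Longrightarrow> \<exists>L. geodesic_line L \<and> p \<in> L \<and> q \<in> L"
    and "\<And>n. 0 < r n \<and> r n \<le> 1"
    and "\<And>n m. n \<noteq> m \<Longrightarrow> (dist (x n) (x m))\<^sup>2 \<ge> 4 * r n * r m"
    and "0 \<le> s" and "s < sqrt 5 - 2"
  shows "(\<Union>n. cball (x n) (s * r n)) \<noteq> UNIV"
proof
  assume cover: "(\<Union>n. cball (x n) (s * r n)) = UNIV"
  have "\<exists>y. \<forall>n. dist y (x n) > r n / 2"
    by (rule separated_half_balls_not_cover) (fact assms)+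
  then obtain y where y: "\<And>n. dist y (x n) > r n / 2" by blast
  from cover obtain n where n: "dist (x n) y \<le> s * r n" by (auto simp: set_eq_iff)
  have "sqrt 5 < 5/2" by (rule real_less_lsqrt) (auto simp: power2_eq_square)
  then have "s * r n \<le> 1/2 * r n" using assms(3)[of n] assms(6) by (intro mult_right_mono) auto
  then show False using n y[of n] by (simp add: dist_commute)
qed

end
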